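(* Let $k \geq 2$ be an integer. Then, viewing elements of $\mathbb{Z}_{2^k}$ as residues of integers, $$S_{2^k} = \{0\} \cup \{ t \cdot 2^s \bmod 2^k : s \in \mathbb{N},\ t \equiv 1 \pmod 4\}$$ and $$N_{2^k} = \{ t \cdot 2^s \bmod 2^k : s \in \mathbb{N},\ t \equiv 3 \pmod 4\}.$$ Consequently $|S_{2^k}| = 2^{k-1}+1$ and $|N_{2^k}| = 2^{k-1}-1$.
   Context: For a positive integer $n$, $\mathbb{Z}_n$ denotes the ring of integers modulo $n$. Define $S_n := \{ m \in \mathbb{Z}_n : m = x^2 + y^2 \text{ for some } x, y \in \mathbb{Z}_n\}$ (zero is allowed as one or both squares) and $N_n := \mathbb{Z}_n \setminus S_n$. For a finite set $A$, $|A|$ is its number of elements. Here $\mathbb{N}$ includes $0$.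
   Formalization: In the formula for N_{2^k} the exponent is restricted to s ≤ k−2; with s an arbitrary natural number the formula is false, since s = k−1 gives 2^(k−1) and s ≥ k gives 0, both sums of two squares (for k=2, N_4 = {3} but 3·2 mod 4 = 2). *)

theory Defs
  imports "HOL-Number_Theory.Number_Theory"
begin

text \<open>The ring of integers modulo \<open>n\<close>, with carrier the least residues \<open>{0..int n - 1}\<close>.\<close>

abbreviation Z_mod :: "nat \<Rightarrow> int ring" where
  "Z_mod n \<equiv> residue_ring (int n)"

definition two_squares_mod :: "nat \<Rightarrow> int set" where
  "two_squares_mod n =
     {m \<in> carrier (Z_mod n). \<exists>x \<in> carrier (Z_mod n). \<exists>y \<in> carrier (Z_mod n).
        m = x [^]\<^bsub>Z_mod n\<^esub> (2::nat) \<oplus>\<^bsub>Z_mod n\<^esub> y [^]\<^bsub>Z_mod n\<^esub> (2::nat)}"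

definition non_two_squares_mod :: "nat \<Rightarrow> int set" where
  "non_two_squares_mod n = carrier (Z_mod n) - two_squares_mod n"

end

theory Submission imports Defs begin

text \<open>
  Everything rests on \<open>2(x\<^sup>2 + y\<^sup>2) = (x + y)\<^sup>2 + (x - y)\<^sup>2\<close>. Read from left to right it reduces the
  representability of \<open>t \<cdot> 2\<^sup>s\<close> with \<open>t \<equiv> 1 (mod 4)\<close> to that of \<open>t\<close>, which follows by lifting an odd
  solution from modulus \<open>2\<^sup>k\<close> to \<open>2\<^sup>k\<^sup>+\<^sup>1\<close>; read from right to left it descends from
  \<open>t \<cdot> 2\<^sup>s\<close> with \<open>t \<equiv> 3 (mod 4)\<close> to \<open>t\<close>, which is excluded modulo 4. Negation exchanges the
  non-sums with the sums other than \<open>0\<close> and \<open>2\<^sup>k\<^sup>-\<^sup>1\<close>, which gives the cardinalities.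
\<close>

section \<open>From the residue ring to integer congruences\<close>

text \<open>Ring operations on least residues are integer operations followed by \<open>mod\<close>,
  and integer witnesses may be reduced modulo \<open>n\<close>. The \<open>residues\<close> locale
  demands a modulus greater than 1.\<close>

lemma mem_two_squares_mod_iff:
  fixes m :: int
  assumes "n \<ge> 2"
  shows "m \<in> two_squares_mod n \<longleftrightarrow>
    0 \<le> m \<and> m < int n \<and> (\<exists>x y :: int. [x\<^sup>2 + y\<^sup>2 = m] (mod int n))"
proof -
  interpret residues "int n" "Z_mod n"
    by unfold_locales (use assms in auto)
  have op: "x [^]\<^bsub>Z_mod n\<^esub> (2::nat) \<oplus>\<^bsub>Z_mod n\<^esub> y [^]\<^bsub>Z_mod n\<^esub> (2::nat)
      = (x\<^sup>2 + y\<^sup>2) mod int n" if "x \<in> {0..<int n}" "y \<in> {0..<int n}" for x y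
  proof -
    have "x [^]\<^bsub>Z_mod n\<^esub> (2::nat) = x\<^sup>2 mod int n" if "x \<in> {0..<int n}" for x
      using pow_cong[of x 2] that by simp
    then show ?thesis
      using that by (simp add: res_add_eq mod_add_eq)
  qed
  have carr: "carrier (Z_mod n) = {0..<int n}"
    by (auto simp: res_carrier_eq)
  show ?thesis
  proof
    assume "m \<in> two_squares_mod n"
    then show "0 \<le> m \<and> m < int n \<and> (\<exists>x y :: int. [x\<^sup>2 + y\<^sup>2 = m] (mod int n))"
      unfolding two_squares_mod_def carr using op by (auto simp: cong_def)
  next
    assume *: "0 \<le> m \<and> m < int n \<and> (\<exists>x y :: int. [x\<^sup>2 + y\<^sup>2 = m] (mod int n))"
    then obtain x y where xy: "(x\<^sup>2 + y\<^sup>2) mod int n = m"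
      by (auto simp: cong_def)
    have "((x mod int n)\<^sup>2 + (y mod int n)\<^sup>2) mod int n = m"
      using xy by (metis mod_add_eq power_mod)
    moreover have "x mod int n \<in> {0..<int n}" "y mod int n \<in> {0..<int n}"
      using assms by auto
    ultimately show "m \<in> two_squares_mod n"
      unfolding two_squares_mod_def carr using * op
      by (smt (verit) atLeastLessThan_iff mem_Collect_eq)
  qed
qed

section \<open>Solvability when the odd part is 1 modulo 4\<close>

text \<open>A solution modulo \<open>2 ^ k\<close> has an error \<open>2 ^ k * c\<close>. If
  \<open>c\<close> is odd, shifting \<open>x\<close> by \<open>2 ^ (k - 1)\<close> adds an odd
  multiple of \<open>2 ^ k\<close> and so repairs the parity. This is why \<open>odd x\<close> is
  carried through the induction.\<close>

lemma two_squares_cong_pow2_lift: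
  fixes t :: int
  assumes "[t = 1] (mod 4)" "k \<ge> 3"
  shows "\<exists>x y :: int. odd x \<and> [x\<^sup>2 + y\<^sup>2 = t] (mod 2 ^ k)"
  using assms(2)
proof (induction k rule: dec_induct)
  case base
  have "t mod 8 = 1 \<or> t mod 8 = 5"
    using assms(1) by (simp add: cong_def) presburger
  then show ?case
  proof
    assume "t mod 8 = 1"
    then show ?thesis by (intro exI[of _ 1] exI[of _ 0]) (simp add: cong_def)
  next
    assume "t mod 8 = 5"
    then show ?thesis by (intro exI[of _ 1] exI[of _ 2]) (simp add: cong_def)
  qed
next
  case (step k)
  then obtain x y where x: "odd x" and "[x\<^sup>2 + y\<^sup>2 = t] (mod 2 ^ k)"
    by blast
  then obtain c where c: "x\<^sup>2 + y\<^sup>2 = t + 2 ^ k * c"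
    by (metis cong_iff_lin cong_sym)
  \<comment> \<open>As k \<ge> 3, the square of the shift is
    \<open>2 ^ (2 * k - 2) = 2 ^ Suc k * 2 ^ j\<close>, which vanishes modulo
    \<open>2 ^ Suc k\<close>.\<close>
  obtain j where j: "k = j + 3"
    using step.hyps by (metis add.commute le_Suc_ex)
  show ?case
  proof (cases "even c")
    case True
    then obtain d where "c = 2 * d" by blast
    then have "x\<^sup>2 + y\<^sup>2 = t + 2 ^ Suc k * d"
      using c by simp
    then show ?thesis using x
      by (intro exI[of _ x] exI[of _ y]) (simp add: cong_def)
  next
    case False
    then obtain d where d: "c + x = 2 * d" using x by (metis odd_even_add evenE)
    have "(x + 2 ^ (k - 1))\<^sup>2 + y\<^sup>2 = x\<^sup>2 + y\<^sup>2 + 2 ^ k * x + 2 ^ Suc k * 2 ^ j"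
      by (simp add: j power2_eq_square algebra_simps power_add flip: power_mult_distrib)
    also have "\<dots> = t + 2 ^ k * (c + x) + 2 ^ Suc k * 2 ^ j"
      using c by (simp add: algebra_simps)
    also have "\<dots> = t + 2 ^ Suc k * (d + 2 ^ j)"
      unfolding d by (simp add: algebra_simps)
    finally have "[(x + 2 ^ (k - 1))\<^sup>2 + y\<^sup>2 = t] (mod 2 ^ Suc k)"
      by (simp only: cong_def mod_mult_self2)
    moreover have "odd (x + 2 ^ (k - 1))"
      using x j by simp
    ultimately show ?thesis by blast
  qed
qed

lemma two_squares_cong_pow2:
  fixes t :: int
  assumes "[t = 1] (mod 4)"
  shows "\<exists>x y :: int. [x\<^sup>2 + y\<^sup>2 = t * 2 ^ s] (mod 2 ^ k)"
proof (induction s)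
  case 0
  \<comment> \<open>Here \<open>k\<close> may be below 3, so the lifting lemma is applied at
    \<open>k + 3\<close> and the solution is then reduced.\<close>
  have "(2::int) ^ k dvd 2 ^ (k + 3)"
    by (simp add: le_imp_power_dvd)
  then show ?case
    using two_squares_cong_pow2_lift[OF assms, of "k + 3"]
    by (metis cong_dvd_modulus le_add2 mult.right_neutral power_0)
next
  case (Suc s)
  then obtain x y where "[x\<^sup>2 + y\<^sup>2 = t * 2 ^ s] (mod 2 ^ k)" by blast
  then have "[2 * (x\<^sup>2 + y\<^sup>2) = 2 * (t * 2 ^ s)] (mod 2 ^ k)"
    by (rule cong_scalar_left)
  moreover have "2 * (x\<^sup>2 + y\<^sup>2) = (x + y)\<^sup>2 + (x - y)\<^sup>2"
    by (simp add: power2_eq_square algebra_simps)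
  ultimately have "[(x + y)\<^sup>2 + (x - y)\<^sup>2 = t * 2 ^ Suc s] (mod 2 ^ k)"
    by (simp add: ac_simps)
  then show ?case by blast
qed

section \<open>The obstruction when the odd part is 3 modulo 4\<close>

lemma sum_two_squares_neq_3_mod_4_times_pow2:
  fixes x y t :: int
  assumes "[t = 3] (mod 4)"
  shows "x\<^sup>2 + y\<^sup>2 \<noteq> t * 2 ^ s"
proof (induction s arbitrary: x y)
  case 0
  have sq: "z\<^sup>2 mod 4 = 0 \<or> z\<^sup>2 mod 4 = 1" for z :: int
  proof (cases "even z")
    case True
    then show ?thesis by (auto elim!: evenE simp: power_mult_distrib)
  next
    case False
    then obtain w where "z = 2 * w + 1" by (blast elim: oddE)
    then have "z\<^sup>2 = 1 + 4 * (w\<^sup>2 + w)"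
      by (simp add: power2_eq_square algebra_simps)
    then show ?thesis by (simp only: mod_mult_self2) simp
  qed
  show ?case
    using sq[of x] sq[of y] assms unfolding cong_def power_0 mult_1_right by presburger
next
  case (Suc s)
  show ?case
  proof
    assume eq: "x\<^sup>2 + y\<^sup>2 = t * 2 ^ Suc s"
    then have "even (x\<^sup>2 + y\<^sup>2)" by simp
    then have "even (x + y)" by simp
    \<comment> \<open>Thus \<open>u\<close> is (x + y)/2 and \<open>u - y\<close> is (x - y)/2; the
      sum of their squares is half of \<open>x\<^sup>2 + y\<^sup>2\<close>.\<close>
    then obtain u where u: "x = 2 * u - y" by (metis add_diff_cancel_right' evenE)
    have "2 * (u\<^sup>2 + (u - y)\<^sup>2) = 2 * (t * 2 ^ s)"
      using eq unfolding u by (simp add: power2_eq_square algebra_simps)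
    with Suc.IH[of u "u - y"] show False by simp
  qed
qed

text \<open>Since \<open>2 ^ k\<close> is a multiple of \<open>4 * 2 ^ s\<close>, the error of the
  congruence can be absorbed into \<open>t\<close> without changing its class modulo 4. What remains
  is an exact equation in integers.\<close>

lemma not_two_squares_cong_pow2:
  fixes x y t :: int
  assumes "[t = 3] (mod 4)" "s + 2 \<le> k"
  shows "\<not> [x\<^sup>2 + y\<^sup>2 = t * 2 ^ s] (mod 2 ^ k)"
proof
  assume "[x\<^sup>2 + y\<^sup>2 = t * 2 ^ s] (mod 2 ^ k)"
  then obtain c where c: "x\<^sup>2 + y\<^sup>2 = t * 2 ^ s + 2 ^ k * c"
    by (metis cong_iff_lin cong_sym)
  obtain j where j: "k = s + 2 + j"
    using assms(2) le_Suc_ex by blast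
  have "x\<^sup>2 + y\<^sup>2 = (t + 4 * (2 ^ j * c)) * 2 ^ s"
    unfolding c j by (simp add: power_add algebra_simps)
  moreover have "[t + 4 * (2 ^ j * c) = 3] (mod 4)"
    using assms(1) by (simp add: cong_def)
  ultimately show False
    using sum_two_squares_neq_3_mod_4_times_pow2 by blast
qed

section \<open>Odd parts of residues and membership\<close>

text \<open>Take \<open>s\<close> to be the 2-adic valuation of \<open>m\<close>. If it exceeded
  \<open>k - 2\<close>, then m < 2 ^ k would force \<open>t = 1\<close> and
  \<open>s = k - 1\<close>, the excluded value.\<close>

lemma odd_part_decomposition:
  fixes m :: int
  assumes "0 < m" "m < 2 ^ k" "m \<noteq> 2 ^ (k - 1)"
  obtains s t where "m = t * 2 ^ s" "odd t" "s + 2 \<le> k"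
proof -
  obtain t where t: "m = 2 ^ multiplicity 2 m * t" "odd t"
    using multiplicity_decompose'[of m 2] assms(1) by auto
  define s where "s = multiplicity 2 m"
  have m: "m = t * 2 ^ s" using t(1) by (simp add: s_def mult.commute)
  have tpos: "t > 0"
    using assms(1) m by (simp add: zero_less_mult_iff)
  have "s + 2 \<le> k"
  proof (rule ccontr)
    assume "\<not> s + 2 \<le> k"
    then have "k \<le> Suc s" by simp
    then have "(2::int) ^ k \<le> 2 * 2 ^ s"
      by (metis one_le_numeral power_Suc power_increasing)
    then have "t * 2 ^ s < 2 * 2 ^ s" using assms(2) m by linarith
    then have "t < 2" by (rule mult_right_less_imp_less) simp
    then have "t = 1" using tpos by simp
    then have "s < k" using assms(2) m by simp
    then have "s = k - 1" using \<open>k \<le> Suc s\<close> by simp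
    then show False using assms(3) m \<open>t = 1\<close> by simp
  qed
  then show thesis using that m t(2) by blast
qed

lemma mod_mem_two_squares_mod_pow2_iff:
  fixes t :: int
  assumes "k \<ge> 1"
  shows "(t * 2 ^ s) mod 2 ^ k \<in> two_squares_mod (2 ^ k) \<longleftrightarrow>
    (\<exists>x y :: int. [x\<^sup>2 + y\<^sup>2 = t * 2 ^ s] (mod 2 ^ k))"
proof -
  have "(2::nat) ^ 1 \<le> 2 ^ k"
    using assms by (intro power_increasing) auto
  then show ?thesis
    by (subst mem_two_squares_mod_iff) (auto simp: cong_def)
qed

text \<open>The bound on \<open>s\<close> ensures that the residue determines \<open>t\<close>
  modulo 4, so the criterion is well defined.\<close>

lemma odd_times_pow2_mem_two_squares_mod_iff:
  fixes t :: int
  assumes "odd t" "s + 2 \<le> k"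
  shows "(t * 2 ^ s) mod 2 ^ k \<in> two_squares_mod (2 ^ k) \<longleftrightarrow> [t = 1] (mod 4)"
proof -
  have "[t = 1] (mod 4) \<or> [t = 3] (mod 4)"
    using assms(1) unfolding cong_def by presburger
  moreover have "k \<ge> 1" using assms(2) by simp
  ultimately show ?thesis
    using two_squares_cong_pow2[of t s k] not_two_squares_cong_pow2[of t s k] assms(2)
    by (auto simp: mod_mem_two_squares_mod_pow2_iff)
qed

lemma zero_mem_two_squares_mod_pow2:
  assumes "k \<ge> 1"
  shows "0 \<in> two_squares_mod (2 ^ k)"
proof -
  have "\<exists>x y :: int. [x\<^sup>2 + y\<^sup>2 = 0 * 2 ^ 0] (mod 2 ^ k)"
    by (intro exI[of _ 0]) simp
  then show ?thesis
    using mod_mem_two_squares_mod_pow2_iff[OF assms, of 0 0] by simp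
qed

lemma half_mem_two_squares_mod_pow2:
  assumes "k \<ge> 1"
  shows "2 ^ (k - 1) \<in> two_squares_mod (2 ^ k)"
proof -
  have "(1 * 2 ^ (k - 1)) mod 2 ^ k \<in> two_squares_mod (2 ^ k)"
    using two_squares_cong_pow2[of 1 "k - 1" k] assms
    by (simp only: mod_mem_two_squares_mod_pow2_iff) simp
  moreover have "(2::int) ^ (k - 1) < 2 ^ k"
    using assms by simp
  ultimately show ?thesis by simp
qed

lemma two_squares_mod_pow2_subset:
  assumes "k \<ge> 1"
  shows "two_squares_mod (2 ^ k) \<subseteq> {0..<2 ^ k}"
proof -
  have "(2::nat) ^ 1 \<le> 2 ^ k"
    using assms by (intro power_increasing) auto
  then show ?thesis
    by (auto simp: mem_two_squares_mod_iff)
qed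

lemma non_two_squares_mod_pow2_eq:
  "non_two_squares_mod (2 ^ k) = {0..<2 ^ k} - two_squares_mod (2 ^ k)"
  by (auto simp: non_two_squares_mod_def residue_ring_def)

section \<open>Explicit descriptions of both sets\<close>

lemma two_squares_mod_pow2:
  assumes "k \<ge> 2"
  shows "two_squares_mod (2 ^ k) =
    {0} \<union> {(t * 2 ^ s) mod 2 ^ k | (s::nat) (t::int). [t = 1] (mod 4)}"
proof (intro equalityI subsetI)
  fix m assume m: "m \<in> two_squares_mod (2 ^ k)"
  then have bounds: "0 \<le> m" "m < 2 ^ k"
    using two_squares_mod_pow2_subset[of k] assms by auto
  consider "m = 0" | "m = 2 ^ (k - 1)" | "0 < m" "m \<noteq> 2 ^ (k - 1)"
    using bounds by fastforce
  then have "m = 0 \<or> (\<exists>s t. m = t * 2 ^ s \<and> [t = 1] (mod 4))"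
  proof cases
    case 2
    then show ?thesis by (metis cong_refl mult_1)
  next
    case 3
    then obtain s t where st: "m = t * 2 ^ s" "odd t" "s + 2 \<le> k"
      using odd_part_decomposition bounds by metis
    then have "[t = 1] (mod 4)"
      using m bounds odd_times_pow2_mem_two_squares_mod_iff[OF st(2,3)] by simp
    then show ?thesis using st(1) by blast
  qed simp
  then show "m \<in> {0} \<union> {(t * 2 ^ s) mod 2 ^ k | (s::nat) (t::int). [t = 1] (mod 4)}"
    using bounds by (smt (verit) UnCI insertCI mem_Collect_eq mod_pos_pos_trivial)
next
  fix m :: int
  assume "m \<in> {0} \<union> {(t * 2 ^ s) mod 2 ^ k | (s::nat) (t::int). [t = 1] (mod 4)}"
  moreover have "k \<ge> 1" using assms by simp
  ultimately show "m \<in> two_squares_mod (2 ^ k)"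
    using zero_mem_two_squares_mod_pow2 two_squares_cong_pow2
    by (auto simp: mod_mem_two_squares_mod_pow2_iff)
qed

lemma non_two_squares_mod_pow2:
  assumes "k \<ge> 2"
  shows "non_two_squares_mod (2 ^ k) =
    {(t * 2 ^ s) mod 2 ^ k | (s::nat) (t::int). s \<le> k - 2 \<and> [t = 3] (mod 4)}"
proof (intro equalityI subsetI)
  fix m assume m: "m \<in> non_two_squares_mod (2 ^ k)"
  have k: "k \<ge> 1" using assms by simp
  have bounds: "0 < m" "m < 2 ^ k" "m \<noteq> 2 ^ (k - 1)"
    using m zero_mem_two_squares_mod_pow2[OF k] half_mem_two_squares_mod_pow2[OF k]
    by (auto simp: non_two_squares_mod_pow2_eq order.strict_iff_order)
  then obtain s t where st: "m = t * 2 ^ s" "odd t" "s + 2 \<le> k"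
    using odd_part_decomposition by metis
  have "m mod 2 ^ k = m" using bounds by simp
  then have "\<not> [t = 1] (mod 4)"
    using m odd_times_pow2_mem_two_squares_mod_iff[OF st(2,3)] st(1)
    by (simp add: non_two_squares_mod_pow2_eq)
  then have "[t = 3] (mod 4)" using st(2) unfolding cong_def by presburger
  moreover have "s \<le> k - 2" using st(3) by simp
  ultimately show
    "m \<in> {(t * 2 ^ s) mod 2 ^ k | (s::nat) (t::int). s \<le> k - 2 \<and> [t = 3] (mod 4)}"
    using \<open>m mod 2 ^ k = m\<close> st(1) by (smt (verit) mem_Collect_eq)
next
  fix m :: int
  assume "m \<in> {(t * 2 ^ s) mod 2 ^ k | (s::nat) (t::int). s \<le> k - 2 \<and> [t = 3] (mod 4)}"
  then obtain s t where st: "m = (t * 2 ^ s) mod 2 ^ k" "s + 2 \<le> k" "[t = 3] (mod 4)"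
    using assms by auto
  have "t mod 4 = 3" using st(3) by (simp add: cong_def)
  then have "odd t" by presburger
  moreover have "\<not> [t = 1] (mod 4)" using \<open>t mod 4 = 3\<close> by (simp add: cong_def)
  ultimately have "m \<notin> two_squares_mod (2 ^ k)"
    using odd_times_pow2_mem_two_squares_mod_iff st(1,2) by blast
  then show "m \<in> non_two_squares_mod (2 ^ k)"
    using st(1) by (simp add: non_two_squares_mod_pow2_eq)
qed

section \<open>Negation and cardinalities\<close>

text \<open>Negation keeps the exponent \<open>s\<close> and swaps the classes 1 and 3 modulo 4 of
  the odd part.\<close>

lemma neg_mem_two_squares_mod_pow2_iff:
  fixes m :: int
  assumes "0 < m" "m < 2 ^ k" "m \<noteq> 2 ^ (k - 1)"
  shows "2 ^ k - m \<in> two_squares_mod (2 ^ k) \<longleftrightarrow> m \<notin> two_squares_mod (2 ^ k)"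
proof -
  obtain s t where st: "m = t * 2 ^ s" "odd t" "s + 2 \<le> k"
    using odd_part_decomposition assms by metis
  have "(t * 2 ^ s) mod 2 ^ k = m" using assms st(1) by simp
  moreover have "(- t * 2 ^ s) mod 2 ^ k = 2 ^ k - m"
    using assms(1) \<open>(t * 2 ^ s) mod 2 ^ k = m\<close> by (simp add: zmod_zminus1_eq_if)
  moreover have "odd (- t)" using st(2) by simp
  moreover have "[- t = 1] (mod 4) \<longleftrightarrow> \<not> [t = 1] (mod 4)"
    using st(2) by (simp add: cong_def) presburger
  ultimately show ?thesis
    using odd_times_pow2_mem_two_squares_mod_iff st(2,3) by metis
qed

lemma card_two_squares_mod_pow2:
  assumes "k \<ge> 2"
  shows "card (two_squares_mod (2 ^ k)) = 2 ^ (k - 1) + 1"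
    and "card (non_two_squares_mod (2 ^ k)) = 2 ^ (k - 1) - 1"
proof -
  let ?S = "two_squares_mod (2 ^ k)" and ?N = "non_two_squares_mod (2 ^ k)"
  have k: "k \<ge> 1" using assms by simp
  have sub: "?S \<subseteq> {0..<2 ^ k}" by (rule two_squares_mod_pow2_subset[OF k])
  then have fin: "finite ?S" by (rule finite_subset) simp
  have special: "0 \<in> ?S" "2 ^ (k - 1) \<in> ?S"
    using zero_mem_two_squares_mod_pow2[OF k] half_mem_two_squares_mod_pow2[OF k] .
  have double: "(2::int) ^ k = 2 * 2 ^ (k - 1)" "(2::nat) ^ k = 2 * 2 ^ (k - 1)"
    using k by (metis One_nat_def Suc_le_D diff_Suc_1 power_Suc)+
  \<comment> \<open>The residues \<open>0\<close> and \<open>2 ^ (k - 1)\<close> are the fixed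
    points of negation, and both are sums of two squares.\<close>
  have generic: "0 < m \<and> m < 2 ^ k \<and> m \<noteq> 2 ^ (k - 1)"
    if "m \<in> ?N \<or> m \<in> ?S - {0, 2 ^ (k - 1)}" for m
  proof -
    have "m \<in> {0..<2 ^ k}" "m \<noteq> 0" "m \<noteq> 2 ^ (k - 1)"
      using that sub special unfolding non_two_squares_mod_pow2_eq by blast+
    then show ?thesis by simp
  qed
  have "bij_betw (\<lambda>m. 2 ^ k - m) ?N (?S - {0, 2 ^ (k - 1)})"
  proof (rule bij_betw_byWitness[where f' = "\<lambda>m. 2 ^ k - m"])
    show "(\<lambda>m. 2 ^ k - m) ` ?N \<subseteq> ?S - {0, 2 ^ (k - 1)}"
    proof (rule image_subsetI)
      fix m assume m: "m \<in> ?N"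
      then have "2 ^ k - m \<in> ?S"
        using generic neg_mem_two_squares_mod_pow2_iff
        by (auto simp: non_two_squares_mod_pow2_eq)
      then show "2 ^ k - m \<in> ?S - {0, 2 ^ (k - 1)}"
        using generic[of m] m double(1) by auto
    qed
    show "(\<lambda>m. 2 ^ k - m) ` (?S - {0, 2 ^ (k - 1)}) \<subseteq> ?N"
    proof (rule image_subsetI)
      fix m assume m: "m \<in> ?S - {0, 2 ^ (k - 1)}"
      then have "2 ^ k - m \<notin> ?S"
        using generic[of m] neg_mem_two_squares_mod_pow2_iff[of m k] by blast
      then show "2 ^ k - m \<in> ?N"
        using generic[of m] m by (auto simp: non_two_squares_mod_pow2_eq)
    qed
  qed auto
  then have "card ?N = card (?S - {0, 2 ^ (k - 1)})"
    by (rule bij_betw_same_card)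
  also have "\<dots> = card ?S - 2"
    using special by (subst card_Diff_subset) auto
  finally have N: "card ?N = card ?S - 2" .
  \<comment> \<open>This bound and \<open>card ?S \<le> 2 ^ k\<close> below keep the subtractions of
    naturals from truncating, so the two equations for \<open>card ?N\<close> can be solved
    linearly.\<close>
  have "card {0, 2 ^ (k - 1) :: int} \<le> card ?S"
    using special fin by (intro card_mono) auto
  then have ge: "2 \<le> card ?S" by simp
  have "card ?N = 2 ^ k - card ?S"
    unfolding non_two_squares_mod_pow2_eq using sub fin
    by (simp add: card_Diff_subset nat_power_eq)
  moreover have "card ?S \<le> 2 ^ k"
    using card_mono[OF _ sub] by (simp add: nat_power_eq)
  ultimately show "card ?S = 2 ^ (k - 1) + 1" "card ?N = 2 ^ (k - 1) - 1"
    using N ge double(2) by linarith+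
qed

(* In the description of the non-sums of two squares the exponent s has to satisfy s <= k - 2:
   for s = k - 1 the residue is 2^(k-1), and for s >= k it is 0, whatever odd t is,
   and both of these are sums of two squares. In the description of the sums of two squares
   s ranges over all natural numbers. *)
theorem theorem1:
  fixes k :: nat
  assumes "k \<ge> 2"
  shows "two_squares_mod (2 ^ k) =
           {0} \<union> {(t * 2 ^ s) mod 2 ^ k | (s::nat) (t::int). [t = 1] (mod 4)}
       \<and> non_two_squares_mod (2 ^ k) =
           {(t * 2 ^ s) mod 2 ^ k | (s::nat) (t::int). s \<le> k - 2 \<and> [t = 3] (mod 4)}
       \<and> card (two_squares_mod (2 ^ k)) = 2 ^ (k - 1) + 1
       \<and> card (non_two_squares_mod (2 ^ k)) = 2 ^ (k - 1) - 1"
  using two_squares_mod_pow2[OF assms] non_two_squares_mod_pow2[OF assms]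
    card_two_squares_mod_pow2[OF assms] by blast

end
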